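(* Let $(R,\mathfrak{m})$ be a commutative reduced local P.Z. ring with Krull dimension $\dim(R)=1$ and let $E$ be an infinite set of minimal primes of $R$. Then the following assertions hold. (i) Let $S:=\prod_{\mathfrak{p}\in E}R_{\mathfrak{p}}$ and let $\pi:R\to S$, $r\mapsto(r/1)_{\mathfrak{p}\in E}$, be the canonical ring map. Then $\operatorname{Im}\pi^{\ast}=E\cup\{\mathfrak{m}\}$, and for every wild prime $P$ of $S$ we have $\pi^{-1}(P)=\mathfrak{m}$. (ii) Let $S:=\prod_{\mathfrak{p}\in E}R/\mathfrak{p}$ and let $\pi:R\to S$, $r\mapsto(r+\mathfrak{p})_{\mathfrak{p}\in E}$, be the canonical ring map. Then $\operatorname{Im}\pi^{\ast}=\overline{E}=E\cup\{\mathfrak{m}\}$, and for every wild prime $P$ of $S$ we have $\pi^{-1}(P)=\mathfrak{m}$. Here $\overline{E}$ denotes the closure of $E$ in $\operatorname{Spec}(R)$ with respect to the Zariski topology.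
   Context: All rings are commutative. A local ring $(R,\mathfrak{m})$ is a ring with a unique maximal ideal $\mathfrak{m}$ (not assumed Noetherian). A P.Z. (properly zipped) ring is a ring $R$ satisfying infinite prime absorbance: if a prime ideal $\mathfrak{p}$ of $R$ contains the intersection of a family $(\mathfrak{p}_i)$ of prime ideals of $R$, then $\mathfrak{p}_k\subseteq\mathfrak{p}$ for some $k$. A ring map $\phi:A\to B$ induces $\phi^{\ast}:\operatorname{Spec}(B)\to\operatorname{Spec}(A)$, $\phi^{\ast}(\mathfrak{q})=\phi^{-1}(\mathfrak{q})$. For a direct product $\prod_{i\in J}A_i$ of nonzero rings with projections $\pi_k:\prod_{i\in J}A_i\to A_k$, a tame prime is a prime ideal of the form $\pi_k^{-1}(\mathfrak{p})$ for some $k\in J$ and some prime ideal $\mathfrak{p}$ of $A_k$; a wild prime is a prime ideal of the product that is not tame. *)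

theory Defs
  imports
    "HOL-Algebra.QuotRing"
    "HOL-Library.Extended_Nat"
    "HOL-Analysis.Abstract_Topology"
begin

section \<open>Prime spectra\<close>

definition Spec :: "('a, 'm) ring_scheme \<Rightarrow> 'a set set" where
  "Spec R = {p. primeideal p R}"

definition minimal_primes :: "('a, 'm) ring_scheme \<Rightarrow> 'a set set" where
  "minimal_primes R = {p \<in> Spec R. \<forall>q \<in> Spec R. q \<subseteq> p \<longrightarrow> q = p}"

text \<open>For a ring map \<open>f\<close> from \<open>R\<close>, the map \<open>spec_map R f\<close> is the induced map into \<open>Spec R\<close>;
  the preimage is relativised to the carrier, since \<open>f\<close> is total on the underlying type.\<close>

definition spec_map :: "('a, 'm) ring_scheme \<Rightarrow> ('a \<Rightarrow> 'b) \<Rightarrow> 'b set \<Rightarrow> 'a set" where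
  "spec_map R f q = {r \<in> carrier R. f r \<in> q}"

definition zariski :: "('a, 'm) ring_scheme \<Rightarrow> 'a set topology" where
  "zariski R = topology (\<lambda>U. \<exists>A \<subseteq> carrier R. U = Spec R - {p \<in> Spec R. A \<subseteq> p})"

text \<open>The next two facts ensure that the abstraction function \<^const>\<open>topology\<close> is applied to a genuine
  topology; it is unspecified otherwise.\<close>

lemma istopology_zariski:
  "istopology (\<lambda>U. \<exists>A \<subseteq> carrier R. U = Spec R - {p \<in> Spec R. A \<subseteq> p})"
  unfolding istopology_def
proof (intro conjI allI impI)
  fix U V
  assume "\<exists>A \<subseteq> carrier R. U = Spec R - {p \<in> Spec R. A \<subseteq> p}"
    and "\<exists>A \<subseteq> carrier R. V = Spec R - {p \<in> Spec R. A \<subseteq> p}"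
  then obtain A B where A: "A \<subseteq> carrier R" "U = Spec R - {p \<in> Spec R. A \<subseteq> p}"
    and B: "B \<subseteq> carrier R" "V = Spec R - {p \<in> Spec R. B \<subseteq> p}" by auto
  let ?C = "{a \<otimes>\<^bsub>R\<^esub> b |a b. a \<in> A \<and> b \<in> B}"
  show "\<exists>A \<subseteq> carrier R. U \<inter> V = Spec R - {p \<in> Spec R. A \<subseteq> p}"
  proof (cases "Spec R = {}")
    case True
    then show ?thesis using A B by auto
  next
    case False
    then have cr: "cring R" unfolding Spec_def primeideal_def by auto
    have "?C \<subseteq> p \<longleftrightarrow> A \<subseteq> p \<or> B \<subseteq> p" if "p \<in> Spec R" for p
    proof -
      interpret primeideal p R using that by (simp add: Spec_def)
      show ?thesis
      proof
        assume C: "?C \<subseteq> p"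
        show "A \<subseteq> p \<or> B \<subseteq> p"
        proof (rule ccontr)
          assume "\<not> ?thesis"
          then obtain a b where "a \<in> A" "a \<notin> p" "b \<in> B" "b \<notin> p" by auto
          moreover have "a \<otimes>\<^bsub>R\<^esub> b \<in> p" using C calculation by auto
          ultimately show False using I_prime A(1) B(1) by blast
        qed
      next
        assume "A \<subseteq> p \<or> B \<subseteq> p"
        then show "?C \<subseteq> p" using A(1) B(1) I_l_closed I_r_closed by blast
      qed
    qed
    moreover have "?C \<subseteq> carrier R"
      using A(1) B(1) cring.cring_simprules(5)[OF cr] by blast
    ultimately show ?thesis unfolding A(2) B(2) by (intro exI[of _ ?C]) blast
  qed
next
  fix \<K>
  assume K: "\<forall>K\<in>\<K>. \<exists>A \<subseteq> carrier R. K = Spec R - {p \<in> Spec R. A \<subseteq> p}"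
  let ?F = "\<lambda>K. SOME A. A \<subseteq> carrier R \<and> K = Spec R - {p \<in> Spec R. A \<subseteq> p}"
  have F: "?F K \<subseteq> carrier R \<and> K = Spec R - {p \<in> Spec R. ?F K \<subseteq> p}" if "K \<in> \<K>" for K
    using someI_ex[of "\<lambda>A. A \<subseteq> carrier R \<and> K = Spec R - {p \<in> Spec R. A \<subseteq> p}"] K that by blast
  have "\<Union>\<K> = Spec R - {p \<in> Spec R. (\<Union>K\<in>\<K>. ?F K) \<subseteq> p}" (is "_ = ?W")
  proof (intro equalityI subsetI)
    fix p assume "p \<in> \<Union>\<K>"
    then obtain K where "K \<in> \<K>" "p \<in> K" by blast
    then show "p \<in> ?W" using F[OF \<open>K \<in> \<K>\<close>] by blast
  next
    fix p assume p: "p \<in> ?W"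
    then obtain K where "K \<in> \<K>" "\<not> ?F K \<subseteq> p" by blast
    then have "p \<in> K" using F[OF \<open>K \<in> \<K>\<close>] p by blast
    then show "p \<in> \<Union>\<K>" using \<open>K \<in> \<K>\<close> by blast
  qed
  moreover have "(\<Union>K\<in>\<K>. ?F K) \<subseteq> carrier R" using F by blast
  ultimately show "\<exists>A \<subseteq> carrier R. \<Union>\<K> = Spec R - {p \<in> Spec R. A \<subseteq> p}" by blast
qed

lemma openin_zariski:
  "openin (zariski R) U \<longleftrightarrow> (\<exists>A \<subseteq> carrier R. U = Spec R - {p \<in> Spec R. A \<subseteq> p})"
  unfolding zariski_def by (simp add: topology_inverse'[OF istopology_zariski])


section \<open>Classes of rings\<close>

definition local_ring :: "('a, 'm) ring_scheme \<Rightarrow> 'a set \<Rightarrow> bool" where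
  "local_ring R m \<longleftrightarrow> cring R \<and> maximalideal m R \<and> (\<forall>n. maximalideal n R \<longrightarrow> n = m)"

definition reduced_ring :: "('a, 'm) ring_scheme \<Rightarrow> bool" where
  "reduced_ring R \<longleftrightarrow> cring R \<and>
     (\<forall>x \<in> carrier R. \<forall>n::nat. x [^]\<^bsub>R\<^esub> n = \<zero>\<^bsub>R\<^esub> \<longrightarrow> x = \<zero>\<^bsub>R\<^esub>)"

text \<open>Supremum of the lengths of strict chains of primes. The zero ring gets dimension \<open>0\<close> here,
  because the supremum of the empty set in \<^typ>\<open>enat\<close> is \<open>0\<close>.\<close>

definition krull_dim :: "('a, 'm) ring_scheme \<Rightarrow> enat" where
  "krull_dim R = (SUP n \<in> {n. \<exists>p :: nat \<Rightarrow> 'a set.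
     (\<forall>i\<le>n. p i \<in> Spec R) \<and> (\<forall>i<n. p i \<subset> p (Suc i))}. enat n)"

text \<open>A family of primes is represented by its set \<open>F\<close> of members. Intersecting with the carrier makes
  the empty family have intersection \<open>carrier R\<close>.\<close>

definition pz_ring :: "('a, 'm) ring_scheme \<Rightarrow> bool" where
  "pz_ring R \<longleftrightarrow> cring R \<and>
     (\<forall>p \<in> Spec R. \<forall>F \<subseteq> Spec R. carrier R \<inter> \<Inter>F \<subseteq> p \<longrightarrow> (\<exists>q \<in> F. q \<subseteq> p))"


section \<open>Localisation\<close>

definition loc_rel :: "('a, 'm) ring_scheme \<Rightarrow> 'a set \<Rightarrow> (('a \<times> 'a) \<times> ('a \<times> 'a)) set" where
  "loc_rel R S = {((a, s), (b, t)).
     a \<in> carrier R \<and> b \<in> carrier R \<and> s \<in> S \<and> t \<in> S \<and>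
     (\<exists>u \<in> S. u \<otimes>\<^bsub>R\<^esub> (a \<otimes>\<^bsub>R\<^esub> t \<ominus>\<^bsub>R\<^esub> b \<otimes>\<^bsub>R\<^esub> s) = \<zero>\<^bsub>R\<^esub>)}"

definition loc_frac :: "('a, 'm) ring_scheme \<Rightarrow> 'a set \<Rightarrow> 'a \<Rightarrow> 'a \<Rightarrow> ('a \<times> 'a) set" where
  "loc_frac R S a s = loc_rel R S `` {(a, s)}"

text \<open>The operations are given on representatives. When \<open>S\<close> is a multiplicative set of a commutative
  ring, all members of each union below coincide.\<close>

definition localization :: "('a, 'm) ring_scheme \<Rightarrow> 'a set \<Rightarrow> ('a \<times> 'a) set ring" where
  "localization R S =
    \<lparr>carrier = (carrier R \<times> S) // loc_rel R S,
     mult = (\<lambda>X Y. \<Union>(a, s) \<in> X. \<Union>(b, t) \<in> Y. loc_frac R S (a \<otimes>\<^bsub>R\<^esub> b) (s \<otimes>\<^bsub>R\<^esub> t)),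
     one = loc_frac R S \<one>\<^bsub>R\<^esub> \<one>\<^bsub>R\<^esub>,
     zero = loc_frac R S \<zero>\<^bsub>R\<^esub> \<one>\<^bsub>R\<^esub>,
     add = (\<lambda>X Y. \<Union>(a, s) \<in> X. \<Union>(b, t) \<in> Y.
              loc_frac R S (a \<otimes>\<^bsub>R\<^esub> t \<oplus>\<^bsub>R\<^esub> b \<otimes>\<^bsub>R\<^esub> s) (s \<otimes>\<^bsub>R\<^esub> t))\<rparr>"

definition localization_at :: "('a, 'm) ring_scheme \<Rightarrow> 'a set \<Rightarrow> ('a \<times> 'a) set ring" where
  "localization_at R p = localization R (carrier R - p)"

definition localization_map :: "('a, 'm) ring_scheme \<Rightarrow> 'a set \<Rightarrow> 'a \<Rightarrow> ('a \<times> 'a) set" where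
  "localization_map R p r = loc_frac R (carrier R - p) r \<one>\<^bsub>R\<^esub>"


section \<open>Direct products\<close>

definition product_ring :: "'i set \<Rightarrow> ('i \<Rightarrow> ('b, 'm) ring_scheme) \<Rightarrow> ('i \<Rightarrow> 'b) ring" where
  "product_ring J A =
    \<lparr>carrier = (\<Pi>\<^sub>E i\<in>J. carrier (A i)),
     mult = (\<lambda>x y. \<lambda>i\<in>J. x i \<otimes>\<^bsub>A i\<^esub> y i),
     one = (\<lambda>i\<in>J. \<one>\<^bsub>A i\<^esub>),
     zero = (\<lambda>i\<in>J. \<zero>\<^bsub>A i\<^esub>),
     add = (\<lambda>x y. \<lambda>i\<in>J. x i \<oplus>\<^bsub>A i\<^esub> y i)\<rparr>"

definition tame_primes :: "'i set \<Rightarrow> ('i \<Rightarrow> ('b, 'm) ring_scheme) \<Rightarrow> ('i \<Rightarrow> 'b) set set" where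
  "tame_primes J A = {spec_map (product_ring J A) (\<lambda>x. x k) p |k p. k \<in> J \<and> p \<in> Spec (A k)}"

definition wild_primes :: "'i set \<Rightarrow> ('i \<Rightarrow> ('b, 'm) ring_scheme) \<Rightarrow> ('i \<Rightarrow> 'b) set set" where
  "wild_primes J A = Spec (product_ring J A) - tame_primes J A"

end

theory Submission
  imports
    Defs
    "HOL-Algebra.Ring_Divisibility"
begin

text \<open>Every prime \<open>q \<noteq> m\<close> of \<open>R\<close> is minimal, so prime absorbance, applied to the members of \<open>E\<close>
  other than \<open>q\<close>, yields an element \<open>x \<notin> q\<close> lying in all of them. In both products the kernel of
  \<open>R\<close> into the factor at \<open>p\<close> is \<open>p\<close>; for \<open>R\<^sub>p\<close> this is where reducedness and minimality enter.
  Hence the image of \<open>x\<close> is supported at \<open>q\<close> only. If a prime \<open>P\<close> of the product lies over \<open>q\<close>, it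
  does not contain that image, so \<open>q \<in> E\<close>, the idempotent at \<open>q\<close> is not in \<open>P\<close>, and \<open>P\<close> is tame.
  Finally, \<open>m\<close> is attained at any prime containing the elements of finite support, which form a
  proper ideal because \<open>E\<close> is infinite.\<close>

section \<open>Existence of primes\<close>

text \<open>Zorn's lemma: the union of a nonempty chain of ideals avoiding \<open>T\<close> is an
  ideal avoiding \<open>T\<close>. Taking \<open>T\<close> multiplicative yields prime ideals, and
  \<open>T = {\<one>}\<close> yields maximal ideals.\<close>

lemma (in ring) exists_ideal_maximal_disjoint:
  assumes "ideal I R" "I \<inter> T = {}"
  obtains P where "ideal P R" "I \<subseteq> P" "P \<inter> T = {}"
    "\<And>J. ideal J R \<Longrightarrow> P \<subseteq> J \<Longrightarrow> J \<inter> T = {} \<Longrightarrow> J = P"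
proof -
  let ?A = "{J. ideal J R \<and> I \<subseteq> J \<and> J \<inter> T = {}}"
  have "\<exists>M\<in>?A. \<forall>X\<in>?A. M \<subseteq> X \<longrightarrow> X = M"
  proof (rule subset_Zorn_nonempty)
    show "?A \<noteq> {}" using assms by blast
  next
    fix C assume C: "C \<noteq> {}" "subset.chain ?A C"
    then have "subset.chain {J. ideal J R} C" by (auto simp: pred_on.chain_def)
    from chain_Union_is_ideal[OF this] C show "\<Union>C \<in> ?A"
      by (auto simp: pred_on.chain_def)
  qed
  then obtain P where P: "ideal P R" "I \<subseteq> P" "P \<inter> T = {}" and max: "\<forall>X\<in>?A. P \<subseteq> X \<longrightarrow> X = P"
    by blast
  have "J = P" if "ideal J R" "P \<subseteq> J" "J \<inter> T = {}" for J
    using max that P(2) by auto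
  then show thesis using that P by blast
qed

text \<open>An ideal maximal among those avoiding a multiplicative set is prime. Adjoining either of
  two elements outside \<open>P\<close> produces an element of \<open>T\<close>; if the product of
  the two lay in \<open>P\<close>, so would the product of these elements of
  \<open>T\<close>.\<close>

lemma (in cring) exists_primeideal_disjoint:
  assumes "ideal I R" "submonoid T R" "I \<inter> T = {}"
  obtains P where "primeideal P R" "I \<subseteq> P" "P \<inter> T = {}"
proof -
  interpret T: submonoid T R by fact
  obtain P where P: "ideal P R" "I \<subseteq> P" "P \<inter> T = {}"
    and max: "\<And>J. ideal J R \<Longrightarrow> P \<subseteq> J \<Longrightarrow> J \<inter> T = {} \<Longrightarrow> J = P"
    using exists_ideal_maximal_disjoint[OF assms(1,3)] by blast
  interpret P: ideal P R by fact
  \<comment> \<open>The ideal \<open>P + (a)\<close> is strictly larger than \<open>P\<close>, so by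
    maximality it meets \<open>T\<close>.\<close>
  have meets: "\<exists>p\<in>P. \<exists>r\<in>carrier R. p \<oplus> r \<otimes> a \<in> T" if a: "a \<in> carrier R" "a \<notin> P" for a
  proof -
    let ?J = "P <+>\<^bsub>R\<^esub> PIdl a"
    have J: "ideal ?J R" by (intro add_ideals P(1) cgenideal_ideal a)
    have mem: "y \<in> ?J \<longleftrightarrow> (\<exists>p\<in>P. \<exists>r\<in>carrier R. y = p \<oplus> r \<otimes> a)" for y
      by (auto simp: set_add_def' cgenideal_def)
    have sub: "P \<subseteq> ?J"
    proof
      fix x assume x: "x \<in> P"
      then have "x = x \<oplus> \<zero> \<otimes> a" using P.a_Hcarr a by simp
      then show "x \<in> ?J" unfolding mem using x by blast
    qed
    have "a = \<zero> \<oplus> \<one> \<otimes> a" using a by simp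
    then have "a \<in> ?J" unfolding mem using P.zero_closed one_closed by blast
    then have "?J \<noteq> P" using a(2) by blast
    then obtain y where "y \<in> ?J" "y \<in> T" using max[OF J sub] by blast
    then show ?thesis by (auto simp: mem)
  qed
  have "primeideal P R"
  proof (rule primeidealI[OF P(1) is_cring])
    show "carrier R \<noteq> P" using P(3) T.one_closed by blast
  next
    fix a b assume ab: "a \<in> carrier R" "b \<in> carrier R" "a \<otimes> b \<in> P"
    show "a \<in> P \<or> b \<in> P"
    proof (rule ccontr)
      assume "\<not> ?thesis"
      then obtain p r q s where h: "p \<in> P" "r \<in> carrier R" "p \<oplus> r \<otimes> a \<in> T"
        "q \<in> P" "s \<in> carrier R" "q \<oplus> s \<otimes> b \<in> T"
        using meets ab by meson
      then have "p \<in> carrier R" "q \<in> carrier R" by (simp_all add: P.a_Hcarr)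
      \<comment> \<open>Each summand of the expansion has \<open>p\<close>, \<open>q\<close> or
        \<open>a \<otimes> b\<close> as a factor, all of which lie in \<open>P\<close>.\<close>
      then have "(p \<oplus> r \<otimes> a) \<otimes> (q \<oplus> s \<otimes> b)
          = p \<otimes> (q \<oplus> s \<otimes> b) \<oplus> (r \<otimes> a \<otimes> q \<oplus> r \<otimes> s \<otimes> (a \<otimes> b))"
        using h ab by algebra
      also have "\<dots> \<in> P" using h ab
        by (simp add: P.I_l_closed P.I_r_closed \<open>q \<in> carrier R\<close>)
      finally show False using T.m_closed[OF h(3,6)] P(3) by blast
    qed
  qed
  then show thesis using that P by blast
qed

text \<open>An ideal is proper exactly when it avoids \<open>{\<one>}\<close>.\<close>

lemma (in ring) exists_maximalideal:
  assumes "ideal I R" "I \<noteq> carrier R"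
  obtains M where "maximalideal M R" "I \<subseteq> M"
proof -
  have one: "\<one> \<in> J \<longleftrightarrow> J = carrier R" if "ideal J R" for J
    using ideal.one_imp_carrier[OF that] by auto
  have "I \<inter> {\<one>} = {}" using assms one by blast
  then obtain P where P: "ideal P R" "I \<subseteq> P" "P \<inter> {\<one>} = {}"
    and max: "\<And>J. ideal J R \<Longrightarrow> P \<subseteq> J \<Longrightarrow> J \<inter> {\<one>} = {} \<Longrightarrow> J = P"
    using exists_ideal_maximal_disjoint[OF assms(1)] by metis
  have "maximalideal P R"
    using P max one by (intro maximalidealI) auto
  then show thesis using that P(2) by blast
qed

lemma (in cring) submonoid_Compl_primeideal:
  assumes "primeideal p R"
  shows "submonoid (carrier R - p) R"
proof -
  interpret p: primeideal p R by fact
  show ?thesis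
    using p.I_prime p.one_imp_carrier p.I_notcarr by unfold_locales auto
qed

text \<open>Otherwise the multiplicative set generated by \<open>x\<close> and the complement of \<open>p\<close> would avoid
  \<open>\<zero>\<close>, and a prime disjoint from it would lie strictly inside \<open>p\<close>.\<close>

lemma (in cring) minimal_prime_annihilated:
  assumes "reduced_ring R" "p \<in> minimal_primes R" "x \<in> p"
  obtains s where "s \<in> carrier R - p" "s \<otimes> x = \<zero>"
proof -
  interpret p: primeideal p R using assms by (simp add: minimal_primes_def Spec_def)
  interpret S: submonoid "carrier R - p" R
    by (rule submonoid_Compl_primeideal) (rule p.primeideal)
  have x: "x \<in> carrier R" using assms(3) by (rule p.a_Hcarr)
  let ?T = "{s \<otimes> x [^] (n::nat) |s n. s \<in> carrier R - p}"
  have T: "submonoid ?T R"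
  proof
    show "?T \<subseteq> carrier R" using x by auto
    show "\<one> \<in> ?T" using S.one_closed by (force intro: exI[of _ "0::nat"])
    fix y z assume "y \<in> ?T" "z \<in> ?T"
    then obtain s n t k where h: "y = s \<otimes> x [^] (n::nat)" "z = t \<otimes> x [^] (k::nat)"
      "s \<in> carrier R - p" "t \<in> carrier R - p" by blast
    then have "y \<otimes> z = (s \<otimes> t) \<otimes> x [^] (n + k)"
      using x by (simp add: nat_pow_mult[symmetric] m_ac)
    then show "y \<otimes> z \<in> ?T" using S.m_closed[OF h(3,4)] by blast
  qed
  have "\<zero> \<in> ?T"
  proof (rule ccontr)
    assume "\<zero> \<notin> ?T"
    then have "{\<zero>} \<inter> ?T = {}" by blast
    then obtain Q where Q: "primeideal Q R" "Q \<inter> ?T = {}"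
      by (rule exists_primeideal_disjoint[OF zeroideal T])
    interpret Q: primeideal Q R by fact
    have "s \<in> ?T" if "s \<in> carrier R - p" for s
      using that by (force intro: exI[of _ s] exI[of _ "0::nat"])
    then have "Q \<subseteq> p" using Q(2) Q.a_subset by blast
    then have "Q = p" using assms(2) Q(1) by (simp add: minimal_primes_def Spec_def)
    moreover have "x \<in> ?T" using S.one_closed x
      by (force intro: exI[of _ \<one>] exI[of _ "1::nat"])
    ultimately show False using Q(2) assms(3) by blast
  qed
  then obtain s n where s: "s \<in> carrier R - p" and "\<zero> = s \<otimes> x [^] (n::nat)" by blast
  then have sn: "s \<otimes> x [^] n = \<zero>" by simp
  have nil: "y = \<zero>" if "y [^] (k::nat) = \<zero>" "y \<in> carrier R" for y k
    using assms(1) that unfolding reduced_ring_def by blast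
  \<comment> \<open>With exponent \<open>n + 1\<close> in place of \<open>n\<close>, the factor
    \<open>s \<otimes> x [^] n\<close> can be split off without treating \<open>n = 0\<close>
    separately.\<close>
  have "(s \<otimes> x) [^] Suc n = (s [^] n \<otimes> x) \<otimes> (s \<otimes> x [^] n)"
    using s x by (simp add: nat_pow_distrib m_ac)
  also have "\<dots> = \<zero>" using s sn x by simp
  finally have "s \<otimes> x = \<zero>" by (rule nil) (use s(1) x in simp)
  then show thesis using that s(1) by blast
qed

section \<open>Localisations\<close>

locale mult_submonoid = cring R + submonoid S R for R (structure) and S

context mult_submonoid
begin

lemma S_carrier [simp]: "s \<in> S \<Longrightarrow> s \<in> carrier R"
  using subset by blast

text \<open>Removing the subtraction makes equality of fractions a matter of rearranging products,
  which commutativity and associativity settle in the proofs below.\<close>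

lemma loc_rel_iff:
  "((a, s), (b, t)) \<in> loc_rel R S \<longleftrightarrow> a \<in> carrier R \<and> b \<in> carrier R \<and> s \<in> S \<and> t \<in> S \<and>
     (\<exists>u \<in> S. u \<otimes> (a \<otimes> t) = u \<otimes> (b \<otimes> s))"
proof -
  have "u \<otimes> (a \<otimes> t \<ominus> b \<otimes> s) = \<zero> \<longleftrightarrow> u \<otimes> (a \<otimes> t) = u \<otimes> (b \<otimes> s)"
    if "a \<in> carrier R" "b \<in> carrier R" "s \<in> S" "t \<in> S" "u \<in> S" for u
  proof -
    have "u \<otimes> (a \<otimes> t \<ominus> b \<otimes> s) = u \<otimes> (a \<otimes> t) \<ominus> u \<otimes> (b \<otimes> s)"
      using that by (simp add: minus_eq r_distr r_minus)
    then show ?thesis using that by (simp add: r_right_minus_eq)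
  qed
  then show ?thesis unfolding loc_rel_def by auto
qed

lemma equiv_loc_rel: "equiv (carrier R \<times> S) (loc_rel R S)"
proof (rule equivI)
  show "loc_rel R S \<subseteq> (carrier R \<times> S) \<times> (carrier R \<times> S)"
    by (auto simp: loc_rel_iff)
  show "refl_on (carrier R \<times> S) (loc_rel R S)"
    by (auto simp: refl_on_def loc_rel_iff intro: one_closed)
  show "sym (loc_rel R S)"
    by (auto simp: sym_def loc_rel_iff) metis
  show "trans (loc_rel R S)"
  proof (rule transI, clarify)
    fix a s b t c w
    assume "((a, s), (b, t)) \<in> loc_rel R S" "((b, t), (c, w)) \<in> loc_rel R S"
    then obtain u v where c: "a \<in> carrier R" "b \<in> carrier R" "c \<in> carrier R" "s \<in> S" "t \<in> S" "w \<in> S"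
      and u: "u \<in> S" "u \<otimes> (a \<otimes> t) = u \<otimes> (b \<otimes> s)"
      and v: "v \<in> S" "v \<otimes> (b \<otimes> w) = v \<otimes> (c \<otimes> t)"
      by (auto simp: loc_rel_iff)
    \<comment> \<open>The witness for transitivity contains the middle denominator \<open>t\<close>
      besides \<open>u\<close> and \<open>v\<close>, because \<open>t\<close> cannot be
      cancelled.\<close>
    have "(u \<otimes> v \<otimes> t) \<otimes> (a \<otimes> w) = (v \<otimes> w) \<otimes> (u \<otimes> (a \<otimes> t))"
      using c u(1) v(1) by (simp add: m_ac)
    also have "\<dots> = (u \<otimes> s) \<otimes> (v \<otimes> (b \<otimes> w))"
      unfolding u(2) using c u(1) v(1) by (simp add: m_ac)
    also have "\<dots> = (u \<otimes> v \<otimes> t) \<otimes> (c \<otimes> s)"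
      unfolding v(2) using c u(1) v(1) by (simp add: m_ac)
    finally show "((a, s), (c, w)) \<in> loc_rel R S"
      using c u(1) v(1) by (auto simp: loc_rel_iff intro!: bexI[of _ "u \<otimes> v \<otimes> t"])
  qed
qed

lemma loc_frac_eq_iff:
  assumes "a \<in> carrier R" "b \<in> carrier R" "s \<in> S" "t \<in> S"
  shows "loc_frac R S a s = loc_frac R S b t \<longleftrightarrow> (\<exists>u \<in> S. u \<otimes> (a \<otimes> t) = u \<otimes> (b \<otimes> s))"
  using eq_equiv_class_iff[OF equiv_loc_rel, of "(a, s)" "(b, t)"] assms
  by (simp add: loc_frac_def loc_rel_iff)

lemma loc_frac_eqI:
  assumes "a \<otimes> t = b \<otimes> s" "a \<in> carrier R" "b \<in> carrier R" "s \<in> S" "t \<in> S"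
  shows "loc_frac R S a s = loc_frac R S b t"
  using assms by (auto simp: loc_frac_eq_iff intro: one_closed)

lemma carrier_localization:
  "carrier (localization R S) = {loc_frac R S a s |a s. a \<in> carrier R \<and> s \<in> S}"
  by (auto simp: localization_def loc_frac_def quotient_def)

lemma loc_frac_closed [simp]:
  "\<lbrakk>a \<in> carrier R; s \<in> S\<rbrakk> \<Longrightarrow> loc_frac R S a s \<in> carrier (localization R S)"
  by (auto simp: carrier_localization)

text \<open>The operations on fractions are unions over representatives. If the value does not
  depend on the representatives, the union is that of a constant family, nonempty since each class
  contains its own representative.\<close>

lemma UN_loc_frac:
  assumes as: "a \<in> carrier R" "s \<in> S" and bt: "b \<in> carrier R" "t \<in> S"
    and eq: "\<And>a' s' b' t'. \<lbrakk>a' \<in> carrier R; s' \<in> S; loc_frac R S a' s' = loc_frac R S a s;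
      b' \<in> carrier R; t' \<in> S; loc_frac R S b' t' = loc_frac R S b t\<rbrakk>
      \<Longrightarrow> g a' s' b' t' = g a s b t"
  shows "(\<Union>(a', s') \<in> loc_frac R S a s. \<Union>(b', t') \<in> loc_frac R S b t. g a' s' b' t')
    = g a s b t"
proof -
  have mem: "c' \<in> carrier R \<and> w' \<in> S \<and> loc_frac R S c' w' = loc_frac R S c w"
    if "(c', w') \<in> loc_frac R S c w" for c' w' c w
    using that equiv_class_eq[OF equiv_loc_rel, of "(c, w)" "(c', w')"]
    by (auto simp: loc_frac_def loc_rel_iff)
  have self: "(a, s) \<in> loc_frac R S a s" "(b, t) \<in> loc_frac R S b t"
    using equiv_class_self[OF equiv_loc_rel] as bt by (auto simp: loc_frac_def)
  have "g a' s' b' t' = g a s b t"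
    if "(a', s') \<in> loc_frac R S a s" "(b', t') \<in> loc_frac R S b t" for a' s' b' t'
    using mem[OF that(1)] mem[OF that(2)] eq by blast
  then have "(\<Union>y \<in> loc_frac R S b t. case y of (b', t') \<Rightarrow> g (fst x) (snd x) b' t') = g a s b t"
    if "x \<in> loc_frac R S a s" for x
    using that self(2) by (intro SUP_eq_const) auto
  then show ?thesis using self(1)
    by (intro SUP_eq_const) (auto simp: case_prod_beta)
qed

lemma loc_frac_mult:
  assumes "a \<in> carrier R" "s \<in> S" "b \<in> carrier R" "t \<in> S"
  shows "loc_frac R S a s \<otimes>\<^bsub>localization R S\<^esub> loc_frac R S b t = loc_frac R S (a \<otimes> b) (s \<otimes> t)"
proof -
  have "loc_frac R S (a' \<otimes> b') (s' \<otimes> t') = loc_frac R S (a \<otimes> b) (s \<otimes> t)"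
    if h: "a' \<in> carrier R" "s' \<in> S" "loc_frac R S a' s' = loc_frac R S a s"
      "b' \<in> carrier R" "t' \<in> S" "loc_frac R S b' t' = loc_frac R S b t" for a' s' b' t'
  proof -
    obtain u v where u: "u \<in> S" "u \<otimes> (a' \<otimes> s) = u \<otimes> (a \<otimes> s')"
      and v: "v \<in> S" "v \<otimes> (b' \<otimes> t) = v \<otimes> (b \<otimes> t')"
      using h assms by (auto simp: loc_frac_eq_iff)
    have "(u \<otimes> v) \<otimes> ((a' \<otimes> b') \<otimes> (s \<otimes> t)) = (u \<otimes> (a' \<otimes> s)) \<otimes> (v \<otimes> (b' \<otimes> t))"
      using h assms u(1) v(1) by (simp add: m_ac)
    also have "\<dots> = (u \<otimes> v) \<otimes> ((a \<otimes> b) \<otimes> (s' \<otimes> t'))"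
      unfolding u(2) v(2) using h assms u(1) v(1) by (simp add: m_ac)
    finally show ?thesis
      using h assms u(1) v(1) by (auto simp: loc_frac_eq_iff intro!: bexI[of _ "u \<otimes> v"])
  qed
  note UN_loc_frac[of a s b t "\<lambda>a s b t. loc_frac R S (a \<otimes> b) (s \<otimes> t)", OF assms this]
  then show ?thesis unfolding localization_def monoid.select_convs .
qed

lemma loc_frac_add:
  assumes "a \<in> carrier R" "s \<in> S" "b \<in> carrier R" "t \<in> S"
  shows "loc_frac R S a s \<oplus>\<^bsub>localization R S\<^esub> loc_frac R S b t
    = loc_frac R S (a \<otimes> t \<oplus> b \<otimes> s) (s \<otimes> t)"
proof -
  have "loc_frac R S (a' \<otimes> t' \<oplus> b' \<otimes> s') (s' \<otimes> t') = loc_frac R S (a \<otimes> t \<oplus> b \<otimes> s) (s \<otimes> t)"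
    if h: "a' \<in> carrier R" "s' \<in> S" "loc_frac R S a' s' = loc_frac R S a s"
      "b' \<in> carrier R" "t' \<in> S" "loc_frac R S b' t' = loc_frac R S b t" for a' s' b' t'
  proof -
    obtain u v where u: "u \<in> S" "u \<otimes> (a' \<otimes> s) = u \<otimes> (a \<otimes> s')"
      and v: "v \<in> S" "v \<otimes> (b' \<otimes> t) = v \<otimes> (b \<otimes> t')"
      using h assms by (auto simp: loc_frac_eq_iff)
    \<comment> \<open>The equation for \<open>a'\<close> is multiplied by
      \<open>v \<otimes> t \<otimes> t'\<close>, the one for \<open>b'\<close> by
      \<open>u \<otimes> s \<otimes> s'\<close>, and the results are added.\<close>
    have "(u \<otimes> v) \<otimes> ((a' \<otimes> t' \<oplus> b' \<otimes> s') \<otimes> (s \<otimes> t))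
        = (v \<otimes> t \<otimes> t') \<otimes> (u \<otimes> (a' \<otimes> s)) \<oplus> (u \<otimes> s \<otimes> s') \<otimes> (v \<otimes> (b' \<otimes> t))"
      using h assms u(1) v(1) by (simp add: m_ac l_distr r_distr)
    also have "\<dots> = (u \<otimes> v) \<otimes> ((a \<otimes> t \<oplus> b \<otimes> s) \<otimes> (s' \<otimes> t'))"
      unfolding u(2) v(2) using h assms u(1) v(1) by (simp add: m_ac l_distr r_distr)
    finally show ?thesis
      using h assms u(1) v(1) by (auto simp: loc_frac_eq_iff intro!: bexI[of _ "u \<otimes> v"])
  qed
  note UN_loc_frac[of a s b t "\<lambda>a s b t. loc_frac R S (a \<otimes> t \<oplus> b \<otimes> s) (s \<otimes> t)", OF assms this]
  then show ?thesis unfolding localization_def ring.select_convs .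
qed

lemma localization_one: "\<one>\<^bsub>localization R S\<^esub> = loc_frac R S \<one> \<one>"
  and localization_zero: "\<zero>\<^bsub>localization R S\<^esub> = loc_frac R S \<zero> \<one>"
  by (simp_all add: localization_def)

lemmas localization_simps = localization_one localization_zero loc_frac_add loc_frac_mult

lemma localization_cases:
  assumes "X \<in> carrier (localization R S)"
  obtains a s where "X = loc_frac R S a s" "a \<in> carrier R" "s \<in> S"
  using assms by (auto simp: carrier_localization)

lemma localization_is_cring: "cring (localization R S)"
proof (rule cringI)
  let ?L = "localization R S"
  show "abelian_group ?L"
  proof (rule abelian_groupI)
    fix X Y assume "X \<in> carrier ?L" "Y \<in> carrier ?L"
    then show "X \<oplus>\<^bsub>?L\<^esub> Y \<in> carrier ?L"
      by (elim localization_cases) (simp add: localization_simps)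
  next
    show "\<zero>\<^bsub>?L\<^esub> \<in> carrier ?L" by (simp add: localization_simps)
  next
    fix X Y Z assume "X \<in> carrier ?L" "Y \<in> carrier ?L" "Z \<in> carrier ?L"
    then show "(X \<oplus>\<^bsub>?L\<^esub> Y) \<oplus>\<^bsub>?L\<^esub> Z = X \<oplus>\<^bsub>?L\<^esub> (Y \<oplus>\<^bsub>?L\<^esub> Z)"
      by (elim localization_cases) (simp add: localization_simps m_ac a_ac l_distr r_distr)
  next
    fix X Y assume "X \<in> carrier ?L" "Y \<in> carrier ?L"
    then show "X \<oplus>\<^bsub>?L\<^esub> Y = Y \<oplus>\<^bsub>?L\<^esub> X"
      by (elim localization_cases) (simp add: localization_simps m_ac a_ac)
  next
    fix X assume "X \<in> carrier ?L"
    then show "\<zero>\<^bsub>?L\<^esub> \<oplus>\<^bsub>?L\<^esub> X = X"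
      by (elim localization_cases) (simp add: localization_simps)
  next
    fix X assume "X \<in> carrier ?L"
    then obtain a s where X: "X = loc_frac R S a s" "a \<in> carrier R" "s \<in> S"
      by (rule localization_cases)
    \<comment> \<open>The sum has denominator \<open>s \<otimes> s\<close>, whereas zero is
      represented with denominator \<open>\<one>\<close>; hence the separate comparison of fractions
      afterwards.\<close>
    have "loc_frac R S (\<ominus> a) s \<oplus>\<^bsub>?L\<^esub> X = loc_frac R S \<zero> (s \<otimes> s)"
      using X by (simp add: localization_simps l_minus l_neg)
    also have "\<dots> = \<zero>\<^bsub>?L\<^esub>"
      using X unfolding localization_zero by (intro loc_frac_eqI) simp_all
    finally show "\<exists>Y\<in>carrier ?L. Y \<oplus>\<^bsub>?L\<^esub> X = \<zero>\<^bsub>?L\<^esub>"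
      using X by (intro bexI[of _ "loc_frac R S (\<ominus> a) s"]) simp_all
  qed
  show "comm_monoid ?L"
  proof (rule comm_monoidI)
    fix X Y assume "X \<in> carrier ?L" "Y \<in> carrier ?L"
    then show "X \<otimes>\<^bsub>?L\<^esub> Y \<in> carrier ?L"
      by (elim localization_cases) (simp add: localization_simps)
  next
    show "\<one>\<^bsub>?L\<^esub> \<in> carrier ?L" by (simp add: localization_simps)
  next
    fix X Y Z assume "X \<in> carrier ?L" "Y \<in> carrier ?L" "Z \<in> carrier ?L"
    then show "(X \<otimes>\<^bsub>?L\<^esub> Y) \<otimes>\<^bsub>?L\<^esub> Z = X \<otimes>\<^bsub>?L\<^esub> (Y \<otimes>\<^bsub>?L\<^esub> Z)"
      by (elim localization_cases) (simp add: localization_simps m_ac)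
  next
    fix X assume "X \<in> carrier ?L"
    then show "\<one>\<^bsub>?L\<^esub> \<otimes>\<^bsub>?L\<^esub> X = X"
      by (elim localization_cases) (simp add: localization_simps)
  next
    fix X Y assume "X \<in> carrier ?L" "Y \<in> carrier ?L"
    then show "X \<otimes>\<^bsub>?L\<^esub> Y = Y \<otimes>\<^bsub>?L\<^esub> X"
      by (elim localization_cases) (simp add: localization_simps m_ac)
  qed
  fix X Y Z assume "X \<in> carrier ?L" "Y \<in> carrier ?L" "Z \<in> carrier ?L"
  then obtain a s b t c w where h:
    "X = loc_frac R S a s" "a \<in> carrier R" "s \<in> S"
    "Y = loc_frac R S b t" "b \<in> carrier R" "t \<in> S"
    "Z = loc_frac R S c w" "c \<in> carrier R" "w \<in> S"
    by (elim localization_cases)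
  \<comment> \<open>On the right, numerator and denominator carry an additional factor
    \<open>w\<close>, so normalising representatives does not suffice and the fractions are
    cross-multiplied.\<close>
  then show "(X \<oplus>\<^bsub>?L\<^esub> Y) \<otimes>\<^bsub>?L\<^esub> Z = X \<otimes>\<^bsub>?L\<^esub> Z \<oplus>\<^bsub>?L\<^esub> Y \<otimes>\<^bsub>?L\<^esub> Z"
    by (simp add: localization_simps)
      (rule loc_frac_eqI; simp add: m_ac l_distr r_distr)
qed

lemma localization_hom: "(\<lambda>r. loc_frac R S r \<one>) \<in> ring_hom R (localization R S)"
  by (rule ring_hom_memI) (auto simp: localization_simps)

lemma loc_frac_eq_zero_iff:
  assumes "a \<in> carrier R" "s \<in> S"
  shows "loc_frac R S a s = \<zero>\<^bsub>localization R S\<^esub> \<longleftrightarrow> (\<exists>u \<in> S. u \<otimes> a = \<zero>)"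
  using assms by (auto simp: localization_zero loc_frac_eq_iff)

end

text \<open>Since every element of \<open>p\<close> is annihilated by some denominator, a fraction
  vanishes exactly when its numerator lies in \<open>p\<close>; primality of \<open>p\<close> then
  excludes zero divisors.\<close>

lemma (in mult_submonoid) localization_is_domain:
  assumes p: "primeideal p R" and S: "S = carrier R - p"
    and zero: "\<And>a. a \<in> p \<Longrightarrow> \<exists>u \<in> S. u \<otimes> a = \<zero>"
  shows "domain (localization R S)"
proof -
  interpret p: primeideal p R by fact
  interpret L: cring "localization R S" by (rule localization_is_cring)
  have zero_iff: "loc_frac R S a s = \<zero>\<^bsub>localization R S\<^esub> \<longleftrightarrow> a \<in> p"
    if as: "a \<in> carrier R" "s \<in> S" for a s
  proof
    assume "loc_frac R S a s = \<zero>\<^bsub>localization R S\<^esub>"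
    then obtain u where u: "u \<in> S" "u \<otimes> a = \<zero>"
      unfolding loc_frac_eq_zero_iff[OF as] by blast
    then have "u \<otimes> a \<in> p" by simp
    then show "a \<in> p" using p.I_prime u(1) as S by blast
  next
    assume "a \<in> p"
    then show "loc_frac R S a s = \<zero>\<^bsub>localization R S\<^esub>"
      using zero by (simp add: loc_frac_eq_zero_iff as)
  qed
  show ?thesis
  proof (intro domain.intro domain_axioms.intro L.is_cring)
    have "\<one> \<notin> p" using one_closed S by blast
    then show "\<one>\<^bsub>localization R S\<^esub> \<noteq> \<zero>\<^bsub>localization R S\<^esub>"
      by (simp add: localization_one zero_iff)
  next
    fix X Y assume XY: "X \<otimes>\<^bsub>localization R S\<^esub> Y = \<zero>\<^bsub>localization R S\<^esub>"
      and "X \<in> carrier (localization R S)" "Y \<in> carrier (localization R S)"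
    then obtain a s b t where h: "X = loc_frac R S a s" "a \<in> carrier R" "s \<in> S"
      "Y = loc_frac R S b t" "b \<in> carrier R" "t \<in> S"
      by (elim localization_cases)
    have "a \<otimes> b \<in> p" using XY h by (simp add: loc_frac_mult zero_iff)
    then show "X = \<zero>\<^bsub>localization R S\<^esub> \<or> Y = \<zero>\<^bsub>localization R S\<^esub>"
      using p.I_prime h zero_iff by blast
  qed
qed

text \<open>These are the three facts about the factor at \<open>p\<close> on which the product
  argument rests; quotients by primes share them. The elements of \<open>p\<close> die because they
  have annihilators outside \<open>p\<close>; conversely \<open>u \<otimes> r = \<zero>\<close> lies
  in \<open>p\<close>, which forces \<open>r\<close> into \<open>p\<close> when \<open>u\<close> is
  outside.\<close>

lemma (in cring) localization_at_minimal_prime: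
  assumes "reduced_ring R" "p \<in> minimal_primes R"
  shows "domain (localization_at R p)"
    and "localization_map R p \<in> ring_hom R (localization_at R p)"
    and "\<And>r. r \<in> carrier R \<Longrightarrow> localization_map R p r = \<zero>\<^bsub>localization_at R p\<^esub> \<longleftrightarrow> r \<in> p"
proof -
  have p: "primeideal p R" using assms(2) by (simp add: minimal_primes_def Spec_def)
  interpret p: primeideal p R by fact
  interpret S: mult_submonoid R "carrier R - p"
    by (intro mult_submonoid.intro is_cring submonoid_Compl_primeideal p)
  have zero: "\<exists>u \<in> carrier R - p. u \<otimes> a = \<zero>" if "a \<in> p" for a
    using minimal_prime_annihilated[OF assms that] by blast
  show "domain (localization_at R p)"
    unfolding localization_at_def by (rule S.localization_is_domain[OF p refl zero])
  show "localization_map R p \<in> ring_hom R (localization_at R p)"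
    using S.localization_hom unfolding localization_at_def localization_map_def[abs_def] .
  show "localization_map R p r = \<zero>\<^bsub>localization_at R p\<^esub> \<longleftrightarrow> r \<in> p" if r: "r \<in> carrier R" for r
  proof -
    have "r \<in> p" if u: "u \<in> carrier R - p" "u \<otimes> r = \<zero>" for u
    proof -
      have "u \<otimes> r \<in> p" using u(2) by simp
      then show "r \<in> p" using p.I_prime u(1) r by blast
    qed
    then show ?thesis
      unfolding localization_at_def localization_map_def S.loc_frac_eq_zero_iff[OF r S.one_closed]
      using zero by blast
  qed
qed

section \<open>Direct products\<close>

lemma product_ring_simps:
  "carrier (product_ring J A) = (\<Pi>\<^sub>E i\<in>J. carrier (A i))"
  "x \<otimes>\<^bsub>product_ring J A\<^esub> y = (\<lambda>i\<in>J. x i \<otimes>\<^bsub>A i\<^esub> y i)"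
  "x \<oplus>\<^bsub>product_ring J A\<^esub> y = (\<lambda>i\<in>J. x i \<oplus>\<^bsub>A i\<^esub> y i)"
  "\<one>\<^bsub>product_ring J A\<^esub> = (\<lambda>i\<in>J. \<one>\<^bsub>A i\<^esub>)"
  "\<zero>\<^bsub>product_ring J A\<^esub> = (\<lambda>i\<in>J. \<zero>\<^bsub>A i\<^esub>)"
  by (simp_all add: product_ring_def)

text \<open>Outside \<open>J\<close> both functions take the value \<open>undefined\<close>, as
  carrier elements are extensional.\<close>

lemma product_ring_eqI:
  assumes "x \<in> carrier (product_ring J A)" "y \<in> carrier (product_ring J A)"
    and "\<And>i. i \<in> J \<Longrightarrow> x i = y i"
  shows "x = y"
  using assms by (auto simp: product_ring_simps intro: PiE_ext)

section \<open>Componentwise arithmetic and elements supported at one index\<close>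

locale ring_family =
  fixes J :: "'i set" and A :: "'i \<Rightarrow> ('b, 'm) ring_scheme"
  assumes cring_component: "\<And>i. i \<in> J \<Longrightarrow> cring (A i)"
begin

text \<open>The ring laws of a factor, selected by position below: 22 is
  \<open>\<ominus> \<zero> = \<zero>\<close>, while 26 and 27 are multiplication by zero from the
  left and from the right.\<close>

lemmas component_rules = cring.cring_simprules[OF cring_component]

abbreviation "S \<equiv> product_ring J A"

lemma component_closed [simp]: "x \<in> carrier S \<Longrightarrow> i \<in> J \<Longrightarrow> x i \<in> carrier (A i)"
  by (auto simp: product_ring_simps)

lemma product_ring_component [simp]:
  assumes "i \<in> J"
  shows "(x \<otimes>\<^bsub>S\<^esub> y) i = x i \<otimes>\<^bsub>A i\<^esub> y i" "(x \<oplus>\<^bsub>S\<^esub> y) i = x i \<oplus>\<^bsub>A i\<^esub> y i"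
    "\<one>\<^bsub>S\<^esub> i = \<one>\<^bsub>A i\<^esub>" "\<zero>\<^bsub>S\<^esub> i = \<zero>\<^bsub>A i\<^esub>"
  using assms by (simp_all add: product_ring_simps)

lemma restrict_closed:
  "(\<And>i. i \<in> J \<Longrightarrow> x i \<in> carrier (A i)) \<Longrightarrow> (\<lambda>i\<in>J. x i) \<in> carrier S"
  by (simp add: product_ring_simps)

lemma product_ring_is_cring: "cring S"
proof (rule cringI)
  have a_closed: "x \<oplus>\<^bsub>S\<^esub> y \<in> carrier S" and m_closed: "x \<otimes>\<^bsub>S\<^esub> y \<in> carrier S"
    if "x \<in> carrier S" "y \<in> carrier S" for x y
    unfolding product_ring_simps(2,3) using that by (auto intro!: restrict_closed component_rules(1,5))
  have zero_closed: "\<zero>\<^bsub>S\<^esub> \<in> carrier S" and one_closed: "\<one>\<^bsub>S\<^esub> \<in> carrier S"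
    unfolding product_ring_simps(4,5) by (auto intro!: restrict_closed component_rules(2,6))
  note closed = a_closed m_closed zero_closed one_closed
  show "abelian_group S"
  proof (rule abelian_groupI)
    fix x assume x: "x \<in> carrier S"
    have y: "(\<lambda>i\<in>J. \<ominus>\<^bsub>A i\<^esub> x i) \<in> carrier S" (is "?y \<in> _")
      using x by (auto intro!: restrict_closed component_rules(3))
    then have "?y \<oplus>\<^bsub>S\<^esub> x = \<zero>\<^bsub>S\<^esub>"
      using x by (intro product_ring_eqI[of _ J A] closed) (simp_all add: component_rules(9))
    then show "\<exists>y\<in>carrier S. y \<oplus>\<^bsub>S\<^esub> x = \<zero>\<^bsub>S\<^esub>" using y by blast
    show "\<zero>\<^bsub>S\<^esub> \<oplus>\<^bsub>S\<^esub> x = x"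
      using x by (intro product_ring_eqI[of _ J A] closed) (simp_all add: component_rules(8))
    fix y assume y: "y \<in> carrier S"
    show "x \<oplus>\<^bsub>S\<^esub> y = y \<oplus>\<^bsub>S\<^esub> x"
      using x y by (intro product_ring_eqI[of _ J A] closed) (simp_all add: component_rules(10))
    fix z assume z: "z \<in> carrier S"
    show "(x \<oplus>\<^bsub>S\<^esub> y) \<oplus>\<^bsub>S\<^esub> z = x \<oplus>\<^bsub>S\<^esub> (y \<oplus>\<^bsub>S\<^esub> z)"
      using x y z by (intro product_ring_eqI[of _ J A] closed) (simp_all add: component_rules(7))
  qed (fact closed)+
  show "comm_monoid S"
  proof (rule comm_monoidI)
    fix x assume x: "x \<in> carrier S"
    show "\<one>\<^bsub>S\<^esub> \<otimes>\<^bsub>S\<^esub> x = x"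
      using x by (intro product_ring_eqI[of _ J A] closed) (simp_all add: component_rules(12))
    fix y assume y: "y \<in> carrier S"
    show "x \<otimes>\<^bsub>S\<^esub> y = y \<otimes>\<^bsub>S\<^esub> x"
      using x y by (intro product_ring_eqI[of _ J A] closed) (simp_all add: component_rules(14))
    fix z assume z: "z \<in> carrier S"
    show "(x \<otimes>\<^bsub>S\<^esub> y) \<otimes>\<^bsub>S\<^esub> z = x \<otimes>\<^bsub>S\<^esub> (y \<otimes>\<^bsub>S\<^esub> z)"
      using x y z by (intro product_ring_eqI[of _ J A] closed) (simp_all add: component_rules(11))
  qed (fact closed)+
  fix x y z assume "x \<in> carrier S" "y \<in> carrier S" "z \<in> carrier S"
  then show "(x \<oplus>\<^bsub>S\<^esub> y) \<otimes>\<^bsub>S\<^esub> z = x \<otimes>\<^bsub>S\<^esub> z \<oplus>\<^bsub>S\<^esub> y \<otimes>\<^bsub>S\<^esub> z"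
    by (intro product_ring_eqI[of _ J A] closed) (simp_all add: component_rules(13))
qed

sublocale S: cring S
  by (rule product_ring_is_cring)

lemma hom_component: "k \<in> J \<Longrightarrow> (\<lambda>x. x k) \<in> ring_hom S (A k)"
  by (rule ring_hom_memI) (auto simp: product_ring_simps)

lemma hom_into_product:
  assumes "\<And>i. i \<in> J \<Longrightarrow> f i \<in> ring_hom R (A i)"
  shows "(\<lambda>r. \<lambda>i\<in>J. f i r) \<in> ring_hom R S"
  using ring_hom_memE[OF assms] by (intro ring_hom_memI) (auto simp: product_ring_simps)

lemma component_uminus: "x \<in> carrier S \<Longrightarrow> i \<in> J \<Longrightarrow> (\<ominus>\<^bsub>S\<^esub> x) i = \<ominus>\<^bsub>A i\<^esub> x i"
proof -
  assume x: "x \<in> carrier S" and i: "i \<in> J"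
  interpret Ai: cring "A i" using i by (rule cring_component)
  interpret ring_hom_cring S "A i" "\<lambda>x. x i"
    using hom_component[OF i] by unfold_locales
  show ?thesis using x by (rule hom_a_inv)
qed

lemma spec_map_component_Spec:
  assumes "k \<in> J" "p \<in> Spec (A k)"
  shows "spec_map S (\<lambda>x. x k) p \<in> Spec S"
proof -
  interpret Ak: cring "A k" using assms(1) by (rule cring_component)
  interpret ring_hom_ring S "A k" "\<lambda>x. x k"
    using hom_component[OF assms(1)] by unfold_locales
  show ?thesis
    using primeideal_vimage[OF S.is_cring] assms(2) by (simp add: Spec_def spec_map_def)
qed

text \<open>The additive and multiplicative, but in general non-unital, inclusion of the
  \<open>k\<close>-th factor. It sends the unit of that factor to the idempotent that cuts out
  coordinate \<open>k\<close>.\<close>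

definition single :: "'i \<Rightarrow> 'b \<Rightarrow> 'i \<Rightarrow> 'b" where
  "single k a = (\<lambda>i\<in>J. if i = k then a else \<zero>\<^bsub>A i\<^esub>)"

lemma single_closed [simp]: "k \<in> J \<Longrightarrow> a \<in> carrier (A k) \<Longrightarrow> single k a \<in> carrier S"
  using component_rules(2)
  by (auto simp: single_def product_ring_simps)

lemma single_component: "k \<in> J \<Longrightarrow> x \<in> carrier S \<Longrightarrow> single k \<one>\<^bsub>A k\<^esub> \<otimes>\<^bsub>S\<^esub> x = single k (x k)"
  using component_rules(12,26)
  by (auto simp: single_def product_ring_simps intro!: restrict_ext)

lemma single_add: "k \<in> J \<Longrightarrow> a \<in> carrier (A k) \<Longrightarrow> b \<in> carrier (A k) \<Longrightarrow>
    single k (a \<oplus>\<^bsub>A k\<^esub> b) = single k a \<oplus>\<^bsub>S\<^esub> single k b"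
  and single_mult: "k \<in> J \<Longrightarrow> a \<in> carrier (A k) \<Longrightarrow> b \<in> carrier (A k) \<Longrightarrow>
    single k (a \<otimes>\<^bsub>A k\<^esub> b) = single k a \<otimes>\<^bsub>S\<^esub> single k b"
  using component_rules(2,8,26)
  by (auto simp: single_def product_ring_simps intro!: restrict_ext)

lemma single_zero: "single k \<zero>\<^bsub>A k\<^esub> = \<zero>\<^bsub>S\<^esub>"
  by (auto simp: single_def product_ring_simps)

lemma single_uminus:
  assumes "k \<in> J" "a \<in> carrier (A k)"
  shows "single k (\<ominus>\<^bsub>A k\<^esub> a) = \<ominus>\<^bsub>S\<^esub> single k a"
proof (rule product_ring_eqI)
  show "single k (\<ominus>\<^bsub>A k\<^esub> a) \<in> carrier S" "\<ominus>\<^bsub>S\<^esub> single k a \<in> carrier S"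
    using assms component_rules(3) by simp_all
  fix i assume "i \<in> J"
  then show "single k (\<ominus>\<^bsub>A k\<^esub> a) i = (\<ominus>\<^bsub>S\<^esub> single k a) i"
    using assms component_rules(22)
    by (simp add: component_uminus) (simp add: single_def)
qed

text \<open>The prime of the \<open>k\<close>-th factor is recovered by pulling \<open>P\<close> back along the (non-unital)
  inclusion of that factor.\<close>

lemma tame_primeI:
  assumes P: "P \<in> Spec S" and k: "k \<in> J" and e: "single k \<one>\<^bsub>A k\<^esub> \<notin> P"
  shows "P \<in> tame_primes J A"
proof -
  interpret P: primeideal P S using P by (simp add: Spec_def)
  interpret Ak: cring "A k" using k by (rule cring_component)
  let ?p = "{a \<in> carrier (A k). single k a \<in> P}"
  \<comment> \<open>Multiplication by an idempotent outside the prime \<open>P\<close> neither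
    creates nor destroys membership in \<open>P\<close>, so only coordinate \<open>k\<close>
    matters.\<close>
  have "x \<in> P \<longleftrightarrow> single k (x k) \<in> P" if x: "x \<in> carrier S" for x
  proof -
    have ek: "single k \<one>\<^bsub>A k\<^esub> \<in> carrier S" using k by simp
    show ?thesis
      using P.I_prime[OF ek x] P.I_l_closed[OF _ ek, of x] e
      unfolding single_component[OF k x] by blast
  qed
  then have "P = spec_map S (\<lambda>x. x k) ?p"
    unfolding spec_map_def using component_closed[OF _ k] P.a_subset by blast
  moreover have "primeideal ?p (A k)"
  proof (rule primeidealI2)
    show "additive_subgroup ?p (A k)"
    proof (intro additive_subgroup.intro subgroup.intro)
      fix a assume a: "a \<in> ?p"
      then have "single k (\<ominus>\<^bsub>A k\<^esub> a) \<in> P" using k by (simp add: single_uminus)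
      then show "inv\<^bsub>add_monoid (A k)\<^esub> a \<in> ?p" unfolding a_inv_def[symmetric] using a by simp
    qed (use k in \<open>auto simp: single_add single_zero\<close>)
    show "cring (A k)" by (rule Ak.is_cring)
    show "carrier (A k) \<noteq> ?p" using e by blast
  next
    fix a x assume "a \<in> ?p" "x \<in> carrier (A k)"
    then show "x \<otimes>\<^bsub>A k\<^esub> a \<in> ?p" "a \<otimes>\<^bsub>A k\<^esub> x \<in> ?p"
      using k by (auto simp: single_mult P.I_l_closed P.I_r_closed)
  next
    fix a b assume "a \<in> carrier (A k)" "b \<in> carrier (A k)" "a \<otimes>\<^bsub>A k\<^esub> b \<in> ?p"
    then show "a \<in> ?p \<or> b \<in> ?p"
      using k P.I_prime by (auto simp: single_mult)
  qed
  ultimately show ?thesis using k unfolding tame_primes_def Spec_def by blast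
qed

text \<open>The support of a sum lies in the union of the supports, and negation and multiplication
  do not enlarge a support.\<close>

lemma ideal_finite_support:
  "ideal {x \<in> carrier S. finite {i \<in> J. x i \<noteq> \<zero>\<^bsub>A i\<^esub>}} S" (is "ideal ?I S")
proof (rule idealI)
  show "subgroup ?I (add_monoid S)"
  proof
    fix x y assume "x \<in> ?I" "y \<in> ?I"
    then have "finite ({i \<in> J. x i \<noteq> \<zero>\<^bsub>A i\<^esub>} \<union> {i \<in> J. y i \<noteq> \<zero>\<^bsub>A i\<^esub>})" by simp
    moreover have "{i \<in> J. (x \<oplus>\<^bsub>S\<^esub> y) i \<noteq> \<zero>\<^bsub>A i\<^esub>}
        \<subseteq> {i \<in> J. x i \<noteq> \<zero>\<^bsub>A i\<^esub>} \<union> {i \<in> J. y i \<noteq> \<zero>\<^bsub>A i\<^esub>}"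
      by (auto simp: component_rules(2,8))
    ultimately show "x \<otimes>\<^bsub>add_monoid S\<^esub> y \<in> ?I"
      using \<open>x \<in> ?I\<close> \<open>y \<in> ?I\<close> by (auto dest: finite_subset)
  next
    fix x assume x: "x \<in> ?I"
    have "{i \<in> J. (\<ominus>\<^bsub>S\<^esub> x) i \<noteq> \<zero>\<^bsub>A i\<^esub>} \<subseteq> {i \<in> J. x i \<noteq> \<zero>\<^bsub>A i\<^esub>}"
      using x by (auto simp: component_uminus component_rules(22))
    then show "inv\<^bsub>add_monoid S\<^esub> x \<in> ?I"
      unfolding a_inv_def[symmetric] using x by (auto dest: finite_subset)
  next
    show "\<one>\<^bsub>add_monoid S\<^esub> \<in> ?I" using S.zero_closed by (simp add: product_ring_simps(5) cong: conj_cong)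
  qed auto
next
  fix a x assume ax: "a \<in> ?I" "x \<in> carrier S"
  have "{i \<in> J. (x \<otimes>\<^bsub>S\<^esub> a) i \<noteq> \<zero>\<^bsub>A i\<^esub>} \<subseteq> {i \<in> J. a i \<noteq> \<zero>\<^bsub>A i\<^esub>}"
    using ax by (auto simp: component_rules(27))
  then show "x \<otimes>\<^bsub>S\<^esub> a \<in> ?I" using ax by (auto dest: finite_subset)
  then show "a \<otimes>\<^bsub>S\<^esub> x \<in> ?I" using ax by (simp add: S.m_comm)
qed (rule S.ring_axioms)

text \<open>The unit has all of the infinite set \<open>J\<close> as its support, so the elements of
  finite support form a proper ideal. A maximal ideal above it contains every
  \<open>single k a\<close>.\<close>

lemma exists_prime_containing_singles:
  assumes "infinite J" and "\<And>i. i \<in> J \<Longrightarrow> \<one>\<^bsub>A i\<^esub> \<noteq> \<zero>\<^bsub>A i\<^esub>"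
  obtains P where "P \<in> Spec S" "\<And>k a. k \<in> J \<Longrightarrow> a \<in> carrier (A k) \<Longrightarrow> single k a \<in> P"
proof -
  let ?I = "{x \<in> carrier S. finite {i \<in> J. x i \<noteq> \<zero>\<^bsub>A i\<^esub>}}"
  have "{i \<in> J. \<one>\<^bsub>S\<^esub> i \<noteq> \<zero>\<^bsub>A i\<^esub>} = J" using assms(2) by (auto simp: product_ring_simps(4))
  then have "\<one>\<^bsub>S\<^esub> \<notin> ?I" using assms(1) by simp
  then have "?I \<noteq> carrier S" by blast
  then obtain P where "maximalideal P S" and I: "?I \<subseteq> P"
    by (rule S.exists_maximalideal[OF ideal_finite_support])
  then have "P \<in> Spec S" by (simp add: Spec_def S.maximalideal_prime)
  moreover have "single k a \<in> P" if "k \<in> J" "a \<in> carrier (A k)" for k a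
  proof -
    have "{i \<in> J. single k a i \<noteq> \<zero>\<^bsub>A i\<^esub>} \<subseteq> {k}" by (auto simp: single_def)
    then have "finite {i \<in> J. single k a i \<noteq> \<zero>\<^bsub>A i\<^esub>}" by (rule finite_subset) simp
    then show ?thesis using I that by auto
  qed
  ultimately show thesis by (rule that)
qed

end

section \<open>Local rings of dimension one\<close>

lemma krull_dim_ge_2:
  assumes "p \<in> Spec R" "q \<in> Spec R" "r \<in> Spec R" "p \<subset> q" "q \<subset> r"
  shows "2 \<le> krull_dim R"
proof -
  let ?c = "\<lambda>i::nat. if i = 0 then p else if i = 1 then q else r"
  have "\<forall>i\<le>2. ?c i \<in> Spec R" "\<forall>i<2. ?c i \<subset> ?c (Suc i)"
    using assms by (auto simp: less_2_cases_iff)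
  then have "enat 2 \<le> krull_dim R"
    unfolding krull_dim_def by (intro SUP_upper CollectI exI[of _ ?c] conjI)
  then show ?thesis by (simp add: numeral_eq_enat)
qed

text \<open>A prime is proper, hence inside some maximal ideal, and \<open>m\<close> is the only
  one.\<close>

lemma local_ring_prime_le_maximal:
  assumes "local_ring R m" "q \<in> Spec R"
  shows "q \<subseteq> m"
proof -
  interpret q: primeideal q R using assms(2) by (simp add: Spec_def)
  obtain M where "maximalideal M R" "q \<subseteq> M"
    by (rule q.exists_maximalideal[OF q.is_ideal q.I_notcarr[symmetric]])
  then show ?thesis using assms(1) unfolding local_ring_def by blast
qed

lemma local_ring_maximal_in_Spec: "local_ring R m \<Longrightarrow> m \<in> Spec R"
  using cring.maximalideal_prime unfolding local_ring_def Spec_def by blast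

text \<open>A prime strictly inside \<open>q\<close> would start a chain of length two ending in
  \<open>q \<subset> m\<close>.\<close>

lemma local_dim_one_minimal_prime:
  assumes "local_ring R m" "krull_dim R = 1" "q \<in> Spec R" "q \<noteq> m"
  shows "q \<in> minimal_primes R"
proof -
  have "q' = q" if "q' \<in> Spec R" "q' \<subseteq> q" for q'
  proof (rule ccontr)
    assume "q' \<noteq> q"
    then have "2 \<le> krull_dim R"
      using that assms local_ring_prime_le_maximal[OF assms(1,3)] local_ring_maximal_in_Spec[OF assms(1)]
      by (intro krull_dim_ge_2[of q' R q m]) auto
    then show False using assms(2) by simp
  qed
  then show ?thesis using assms(3) by (simp add: minimal_primes_def)
qed

text \<open>This is the closed set cut out by the ideal of elements common to all members of
  \<open>E\<close>. Intersecting with the carrier gives the right answer for empty \<open>E\<close>: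
  no prime contains the carrier, so the closure is empty.\<close>

lemma zariski_closure_of:
  assumes "E \<subseteq> Spec R"
  shows "zariski R closure_of E = {q \<in> Spec R. carrier R \<inter> \<Inter>E \<subseteq> q}"
proof -
  have sub: "p \<subset> carrier R" if "p \<in> Spec R" for p
  proof -
    interpret p: primeideal p R using that by (simp add: Spec_def)
    show ?thesis using p.a_subset p.I_notcarr by blast
  qed
  have "topspace (zariski R) = Spec R"
  proof
    show "topspace (zariski R) \<subseteq> Spec R"
      unfolding topspace_def by (auto simp: openin_zariski)
    have "Spec R = Spec R - {p \<in> Spec R. carrier R \<subseteq> p}" using sub by blast
    then have "openin (zariski R) (Spec R)" unfolding openin_zariski by blast
    then show "Spec R \<subseteq> topspace (zariski R)" by (rule openin_subset)
  qed
  note closure = in_closure_of[of _ "zariski R" E, unfolded this]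
  show ?thesis
  proof (intro equalityI subsetI)
    fix q assume "q \<in> zariski R closure_of E"
    then have q: "q \<in> Spec R" and meets: "\<And>T. q \<in> T \<Longrightarrow> openin (zariski R) T \<Longrightarrow> \<exists>p\<in>E. p \<in> T"
      unfolding closure by blast+
    let ?T = "Spec R - {p \<in> Spec R. carrier R \<inter> \<Inter>E \<subseteq> p}"
    have "openin (zariski R) ?T" unfolding openin_zariski by (intro exI[of _ "carrier R \<inter> \<Inter>E"]) simp
    then have "q \<notin> ?T" using meets[of ?T] by blast
    then show "q \<in> {q \<in> Spec R. carrier R \<inter> \<Inter>E \<subseteq> q}" using q by blast
  next
    fix q assume q: "q \<in> {q \<in> Spec R. carrier R \<inter> \<Inter>E \<subseteq> q}"
    have "\<exists>p. p \<in> E \<and> p \<in> T" if T: "q \<in> T" "openin (zariski R) T" for T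
    proof -
      obtain B where B: "B \<subseteq> carrier R" "T = Spec R - {p \<in> Spec R. B \<subseteq> p}"
        using T(2) unfolding openin_zariski by blast
      then have "\<not> B \<subseteq> q" using T(1) q by blast
      \<comment> \<open>If all members of \<open>E\<close> contained \<open>B\<close>, so would
        \<open>q\<close>, and \<open>T\<close> would not be a neighbourhood of
        \<open>q\<close>.\<close>
      then have "\<not> B \<subseteq> carrier R \<inter> \<Inter>E" using q by blast
      then obtain p where "p \<in> E" "\<not> B \<subseteq> p" using B(1) by blast
      then show ?thesis using B(2) assms by blast
    qed
    then show "q \<in> zariski R closure_of E" unfolding closure using q by blast
  qed
qed

text \<open>By prime absorbance, a prime in the closure contains some member of \<open>E\<close>; it
  is \<open>m\<close>, or else minimal and equal to that member. Conversely \<open>m\<close>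
  contains any member of \<open>E\<close>, and one exists.\<close>

lemma local_dim_one_closure:
  assumes "local_ring R m" "pz_ring R" "krull_dim R = 1" "E \<subseteq> minimal_primes R" "E \<noteq> {}"
  shows "zariski R closure_of E = E \<union> {m}"
proof -
  have E: "E \<subseteq> Spec R" using assms(4) by (auto simp: minimal_primes_def)
  show ?thesis unfolding zariski_closure_of[OF E]
  proof (intro equalityI subsetI)
    fix q assume "q \<in> {q \<in> Spec R. carrier R \<inter> \<Inter>E \<subseteq> q}"
    then obtain p where "q \<in> Spec R" "p \<in> E" "p \<subseteq> q"
      using assms(2) E unfolding pz_ring_def by blast
    then show "q \<in> E \<union> {m}"
      using local_dim_one_minimal_prime[OF assms(1,3)] E by (auto simp: minimal_primes_def)
  next
    fix q assume "q \<in> E \<union> {m}"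
    moreover obtain p where "p \<in> E" using assms(5) by blast
    ultimately show "q \<in> {q \<in> Spec R. carrier R \<inter> \<Inter>E \<subseteq> q}"
      using E local_ring_prime_le_maximal[OF assms(1)] local_ring_maximal_in_Spec[OF assms(1)] by blast
  qed
qed

text \<open>Both products are treated at once: the factors enter through being domains and through
  the kernels of the maps from \<open>R\<close>.\<close>

lemma spec_map_product:
  fixes R :: "('a, 'b) ring_scheme" and A :: "'a set \<Rightarrow> ('c, 'd) ring_scheme"
  assumes loc: "local_ring R m" and pz: "pz_ring R" and dim: "krull_dim R = 1"
    and E: "E \<subseteq> minimal_primes R" and inf: "infinite E"
    and dom: "\<And>p. p \<in> E \<Longrightarrow> domain (A p)"
    and hom: "\<And>p. p \<in> E \<Longrightarrow> f p \<in> ring_hom R (A p)"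
    and ker: "\<And>p r. p \<in> E \<Longrightarrow> r \<in> carrier R \<Longrightarrow> f p r = \<zero>\<^bsub>A p\<^esub> \<longleftrightarrow> r \<in> p"
  shows "spec_map R (\<lambda>r. \<lambda>p\<in>E. f p r) ` Spec (product_ring E A) = E \<union> {m}"
    and "\<And>P. P \<in> wild_primes E A \<Longrightarrow> spec_map R (\<lambda>r. \<lambda>p\<in>E. f p r) P = m"
proof -
  let ?\<pi> = "\<lambda>r. \<lambda>p\<in>E. f p r"
  interpret R: cring R using loc by (simp add: local_ring_def)
  interpret ring_family E A
    by (intro ring_family.intro domain.axioms(1) dom)
  interpret \<pi>: ring_hom_ring R S ?\<pi>
    using hom_into_product[of f R] hom by unfold_locales blast
  have ESpec: "E \<subseteq> Spec R" using E by (auto simp: minimal_primes_def)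
  \<comment> \<open>The first conjunct bounds the image; the second makes \<open>P\<close> tame, and
    it also forces any prime containing all \<open>single k a\<close> to lie over
    \<open>m\<close>.\<close>
  have key: "spec_map R ?\<pi> P \<in> E \<and> (\<exists>a \<in> carrier (A (spec_map R ?\<pi> P)). single (spec_map R ?\<pi> P) a \<notin> P)"
    if P: "P \<in> Spec S" and neq: "spec_map R ?\<pi> P \<noteq> m" for P
  proof -
    define q where "q = spec_map R ?\<pi> P"
    interpret P: primeideal P S using P by (simp add: Spec_def)
    have q: "q \<in> Spec R"
      using \<pi>.primeideal_vimage[OF R.is_cring P.primeideal]
      by (simp add: Spec_def q_def spec_map_def)
    have min: "q \<in> minimal_primes R"
      using local_dim_one_minimal_prime[OF loc dim q] neq by (simp add: q_def)
    \<comment> \<open>Otherwise absorbance would give a member of \<open>E - {q}\<close> inside the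
      minimal prime \<open>q\<close>, hence equal to \<open>q\<close>.\<close>
    have "\<not> carrier R \<inter> \<Inter>(E - {q}) \<subseteq> q"
    proof
      assume "carrier R \<inter> \<Inter>(E - {q}) \<subseteq> q"
      moreover have "E - {q} \<subseteq> Spec R" using ESpec by blast
      ultimately obtain p where "p \<in> E - {q}" "p \<subseteq> q"
        using pz q unfolding pz_ring_def by meson
      then show False using min ESpec by (auto simp: minimal_primes_def)
    qed
    then obtain x where x: "x \<in> carrier R" "\<And>p. p \<in> E \<Longrightarrow> p \<noteq> q \<Longrightarrow> x \<in> p" "x \<notin> q" by blast
    have notin: "?\<pi> x \<notin> P" using x(1,3) by (simp add: q_def spec_map_def)
    have "q \<in> E"
    proof (rule ccontr)
      assume "q \<notin> E"
      then have "?\<pi> x = \<zero>\<^bsub>S\<^esub>"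
        using x ker by (auto simp: product_ring_simps intro!: restrict_ext)
      then show False using notin by simp
    qed
    moreover have "?\<pi> x = single q (f q x)"
      unfolding single_def using x ker by (auto intro!: restrict_ext)
    moreover have "f q x \<in> carrier (A q)"
      using ring_hom_closed[OF hom x(1)] \<open>q \<in> E\<close> by blast
    ultimately show ?thesis using notin unfolding q_def[symmetric] by auto
  qed
  show "spec_map R ?\<pi> P = m" if P: "P \<in> wild_primes E A" for P
  proof (rule ccontr)
    assume "spec_map R ?\<pi> P \<noteq> m"
    then obtain q a where q: "q \<in> E" "a \<in> carrier (A q)" "single q a \<notin> P"
      using key P unfolding wild_primes_def by blast
    interpret P: primeideal P S using P by (simp add: wild_primes_def Spec_def)
    interpret Aq: domain "A q" using q(1) by (rule dom)
    \<comment> \<open>The idempotent divides \<open>single q a\<close>, so it is outside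
      \<open>P\<close> as well.\<close>
    have "single q a = single q \<one>\<^bsub>A q\<^esub> \<otimes>\<^bsub>S\<^esub> single q a"
      using single_mult[of q "\<one>\<^bsub>A q\<^esub>" a] q by simp
    then have "single q \<one>\<^bsub>A q\<^esub> \<notin> P"
      using P.I_r_closed[of "single q \<one>\<^bsub>A q\<^esub>" "single q a"] q by auto
    then show False using tame_primeI[OF _ q(1)] P unfolding wild_primes_def by blast
  qed
  show "spec_map R ?\<pi> ` Spec S = E \<union> {m}"
  proof (intro equalityI subsetI)
    fix q assume "q \<in> spec_map R ?\<pi> ` Spec S"
    then show "q \<in> E \<union> {m}" using key by auto
  next
    fix q assume "q \<in> E \<union> {m}"
    then consider "q \<in> E" | "q = m" by blast
    then show "q \<in> spec_map R ?\<pi> ` Spec S"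
    proof cases
      case 1
      interpret Aq: domain "A q" using 1 by (rule dom)
      interpret q: primeideal q R using 1 ESpec by (auto simp: Spec_def)
      \<comment> \<open>The zero ideal of the domain \<open>A q\<close> is prime, and its
        contraction to \<open>R\<close> is the kernel of \<open>f q\<close>, which is
        \<open>q\<close>.\<close>
      let ?P = "spec_map S (\<lambda>x. x q) {\<zero>\<^bsub>A q\<^esub>}"
      have "?P \<in> Spec S"
        using spec_map_component_Spec[OF 1] Aq.zeroprimeideal by (simp add: Spec_def)
      moreover have "spec_map R ?\<pi> ?P = q"
        using ker[OF 1] q.a_subset \<pi>.hom_closed 1 by (auto simp: spec_map_def)
      ultimately show ?thesis by blast
    next
      case 2
      obtain P where P: "P \<in> Spec S" "\<And>k a. k \<in> E \<Longrightarrow> a \<in> carrier (A k) \<Longrightarrow> single k a \<in> P"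
        using exists_prime_containing_singles[OF inf] domain.one_not_zero[OF dom] by metis
      then have "spec_map R ?\<pi> P = m" using key by blast
      then show ?thesis using P(1) 2 by blast
    qed
  qed
qed

section \<open>Localisations and residue rings as the two families of factors\<close>

theorem theorem3p11:
  fixes R :: "('a, 'b) ring_scheme" and m :: "'a set" and E :: "'a set set"
  assumes "local_ring R m"
    and "reduced_ring R"
    and "pz_ring R"
    and "krull_dim R = 1"
    and "E \<subseteq> minimal_primes R"
    and "infinite E"
  shows
    "(let S = product_ring E (\<lambda>p. localization_at R p);
          \<pi> = (\<lambda>r. \<lambda>p\<in>E. localization_map R p r)
      in spec_map R \<pi> ` Spec S = E \<union> {m} \<and>
         (\<forall>P \<in> wild_primes E (\<lambda>p. localization_at R p). spec_map R \<pi> P = m)) \<and>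
     (let S = product_ring E (\<lambda>p. R Quot p);
          \<pi> = (\<lambda>r. \<lambda>p\<in>E. p +>\<^bsub>R\<^esub> r)
      in spec_map R \<pi> ` Spec S = zariski R closure_of E \<and>
         zariski R closure_of E = E \<union> {m} \<and>
         (\<forall>P \<in> wild_primes E (\<lambda>p. R Quot p). spec_map R \<pi> P = m))"
proof -
  interpret R: cring R using assms(1) by (simp add: local_ring_def)
  have min: "p \<in> minimal_primes R" if "p \<in> E" for p using assms(5) that by blast
  have prime: "primeideal p R" if "p \<in> E" for p
    using min[OF that] by (simp add: minimal_primes_def Spec_def)
  note localization = R.localization_at_minimal_prime[OF assms(2) min]
  have ker: "p +>\<^bsub>R\<^esub> r = \<zero>\<^bsub>R Quot p\<^esub> \<longleftrightarrow> r \<in> p" if "p \<in> E" "r \<in> carrier R" for p r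
  proof -
    interpret p: primeideal p R using that(1) by (rule prime)
    show ?thesis
      using p.rcos_const_imp_mem[OF that(2)] p.a_rcos_const by (auto simp: FactRing_def)
  qed
  note product = spec_map_product[OF assms(1,3-6)]
  note i = product[of "localization_at R" "localization_map R", OF localization]
  note ii = product[of "\<lambda>p. R Quot p" "\<lambda>p r. p +>\<^bsub>R\<^esub> r",
      OF primeideal.quotient_is_domain[OF prime]
        ideal.rcos_ring_hom[OF primeideal.axioms(1)[OF prime]] ker]
  have closure: "zariski R closure_of E = E \<union> {m}"
    using assms(6) by (intro local_dim_one_closure[OF assms(1,3-5)]) auto
  show ?thesis
    \<comment> \<open>Once the closure is rewritten as \<open>E \<union> {m}\<close>, the first
      claim of (ii) is the image formula for residue rings and the second holds by
      reflexivity.\<close>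
    unfolding Let_def closure
    by (intro conjI ballI i ii refl)
qed

end
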